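(* Every separable metrizable abelian topological group is isomorphic, as a topological group, to a topological subgroup of a completely metrizable monothetic topological group.
   Context: A topological group is monothetic if it contains an element generating a dense cyclic subgroup (no local compactness is assumed). A topological subgroup is a subgroup equipped with the subspace topology. *)

theory Defs
  imports "HOL-Analysis.Analysis" "HOL-Algebra.Generated_Groups"
begin

locale topological_group = group G for G (structure) +
  fixes T :: "'a topology"
  assumes topspace_eq_carrier: "topspace T = carrier G"
    and continuous_mult: "continuous_map (prod_topology T T) T (\<lambda>(x, y). x \<otimes> y)"
    and continuous_inv: "continuous_map T T (\<lambda>x. inv x)"

definition monothetic :: "('a, 'b) monoid_scheme \<Rightarrow> 'a topology \<Rightarrow> bool"
  where "monothetic G T \<longleftrightarrow> (\<exists>g\<in>carrier G. T closure_of (generate G {g}) = topspace T)"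

definition topological_group_iso ::
  "('a, 'c) monoid_scheme \<Rightarrow> 'a topology \<Rightarrow> ('b, 'd) monoid_scheme \<Rightarrow> 'b topology \<Rightarrow> ('a \<Rightarrow> 'b) set"
  where "topological_group_iso G T H S = {f. f \<in> iso G H \<and> homeomorphic_map T S f}"

(* A theorem cannot quantify existentially over types, so the existence of a monothetic,
   completely metrizable group has to be stated on a fixed type. Type real suffices: such a
   group is separable and metrizable, hence has at most continuum many elements, and its
   group structure and topology can be transported along an injection into the reals.
   The topology on the carrier is an arbitrary one, not the usual topology of the reals. *)

end

theory Submission
  imports Defs
begin

text \<open>By Birkhoff and Kakutani the topology of \<open>G\<close> comes from a group norm \<open>N \<le> 1\<close>. Let \<open>d k\<close> run
  through a dense set, each element occurring infinitely often. Adjoin a free generator \<open>z\<close> to \<open>G\<close>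
  and take the largest seminorm bounded by \<open>N\<close> on \<open>G\<close> and by \<open>1 / (k + 1)\<close> at \<open>k! z - d k\<close>. It makes
  the multiples of \<open>z\<close> dense, and because \<open>k!\<close> grows so fast and \<open>N \<le> 1\<close> it still restricts to \<open>N\<close>
  on \<open>G\<close>. So \<open>G\<close> embeds isometrically into the completion of the integers with respect to the
  seminorm of \<open>n z\<close>, which is monothetic.\<close>

section \<open>Birkhoff--Kakutani\<close>

text \<open>The danger in prescribing small values at the \<open>k! z - d k\<close> is that a
  combination of them in which \<open>z\<close> cancels lies in \<open>G\<close>, and its seminorm
  is at most the cost of the combination, even if its norm \<open>N\<close> is large. The values
  \<open>1 / (k + 1)\<close> must tend to 0 to make multiples of \<open>z\<close> approach
  \<open>G\<close>, so single terms are cheap and only their number can help. The factorials are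
  chosen for \<open>(k + 1) * k! \<le> K!\<close> whenever \<open>k < K\<close>: per unit of cost,
  index \<open>k\<close> contributes at most \<open>K!\<close> to the multiple of \<open>z\<close>,
  so cancelling a top term costs at least 1. With \<open>N\<close> bounded by 1 this threshold
  suffices, whatever relations hold among the \<open>d k\<close>.

  The direct sum of \<open>G\<close> and the multiples of \<open>z\<close> is never built as a
  group. An element \<open>x\<close> of \<open>G\<close> enters through the function sending
  \<open>n\<close> to the seminorm of \<open>n z - x\<close>. That this function describes a point
  of the completion of the integers, and not merely of a larger space, expresses that multiples of
  \<open>z\<close> come arbitrarily close to \<open>x\<close>.\<close>

text \<open>The entry \<open>y\<close> is where the partial sums cross the level \<open>t\<close>.
  It is applied with \<open>t\<close> equal to half of the total weight of a word.\<close>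

lemma sum_list_split_at:
  fixes w :: "'b \<Rightarrow> real"
  assumes "\<And>x. 0 \<le> w x" and "xs \<noteq> []" and "t \<le> sum_list (map w xs)"
    and "0 \<le> t"
  shows "\<exists>ys y zs. xs = ys @ y # zs \<and> sum_list (map w ys) \<le> t \<and>
    t \<le> sum_list (map w ys) + w y"
  using assms(2-4)
proof (induction xs arbitrary: t)
  case (Cons x xs)
  show ?case
  proof (cases "t \<le> w x")
    case True
    then show ?thesis using Cons.prems by (intro exI[of _ "[]"]) auto
  next
    case False
    then have "xs \<noteq> []" using Cons.prems by auto
    then obtain ys y zs where "xs = ys @ y # zs" "sum_list (map w ys) \<le> t - w x"
      "t - w x \<le> sum_list (map w ys) + w y"
      using Cons.IH[of "t - w x"] Cons.prems False by auto
    then show ?thesis by (intro exI[of _ "x # ys"] exI[of _ y] exI[of _ zs]) auto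
  qed
qed simp

section \<open>Words in a chain of neighbourhoods and the norm they define\<close>

primrec (in monoid) list_mult :: "(nat \<Rightarrow> 'a set) \<Rightarrow> nat list \<Rightarrow> 'a set" where
  "list_mult U [] = {\<one>}"
| "list_mult U (n # ns) = U n <#> list_mult U ns"

definition dyadic_weight :: "nat list \<Rightarrow> real" where
  "dyadic_weight ns = sum_list (map (\<lambda>n. (1 / 2) ^ n) ns)"

lemma dyadic_weight_simps [simp]:
  "dyadic_weight [] = 0"
  "dyadic_weight (n # ns) = (1 / 2) ^ n + dyadic_weight ns"
  "dyadic_weight (ms @ ns) = dyadic_weight ms + dyadic_weight ns"
  by (simp_all add: dyadic_weight_def)

lemma dyadic_weight_nonneg: "0 \<le> dyadic_weight ns"
  by (induction ns) auto

text \<open>Triple products match a cut of a word into a left part, one letter and a right part.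
  Taking \<open>U 0\<close> to be the whole group gives every element a word of weight 1, hence the
  bound 1 on the norm.\<close>

locale group_nbhd_chain = comm_group G for G (structure) +
  fixes U :: "nat \<Rightarrow> 'a set"
  assumes U_carrier: "U n \<subseteq> carrier G"
    and U_0: "U 0 = carrier G"
    and U_one: "\<one> \<in> U n"
    and U_inv: "x \<in> U n \<Longrightarrow> inv x \<in> U n"
    and U_triple: "x \<in> U (Suc n) \<Longrightarrow> y \<in> U (Suc n) \<Longrightarrow> z \<in> U (Suc n) \<Longrightarrow> x \<otimes> y \<otimes> z \<in> U n"
begin

lemma U_antimono: "m \<le> n \<Longrightarrow> U n \<subseteq> U m"
proof (induction rule: dec_induct)
  case (step n)
  have "x \<in> U n" if "x \<in> U (Suc n)" for x
    using U_triple[OF that U_one U_one] subsetD[OF U_carrier that] by simp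
  then show ?case using step by auto
qed simp

lemma list_mult_carrier: "list_mult U ns \<subseteq> carrier G"
  by (induction ns) (simp_all add: U_carrier set_mult_closed)

lemma list_mult_append: "list_mult U (ms @ ns) = list_mult U ms <#> list_mult U ns"
proof (induction ms)
  case Nil
  have "{\<one>} <#> list_mult U ns = list_mult U ns"
    using list_mult_carrier[of ns] by (force simp: set_mult_def)
  then show ?case by simp
next
  case (Cons m ms)
  then show ?case
    using set_mult_assoc[OF U_carrier list_mult_carrier list_mult_carrier] by simp
qed

lemma list_mult_inv: "x \<in> list_mult U ns \<Longrightarrow> inv x \<in> list_mult U ns"
proof (induction ns arbitrary: x)
  case (Cons n ns)
  then obtain u v where uv: "x = u \<otimes> v" "u \<in> U n" "v \<in> list_mult U ns"
    by (auto simp: set_mult_def)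
  then have "inv x = inv u \<otimes> inv v"
    using U_carrier list_mult_carrier by (auto intro!: inv_mult)
  then show ?case
    using U_inv[OF uv(2)] Cons.IH[OF uv(3)] by (auto simp: set_mult_def)
qed simp

text \<open>The classical estimate behind the Birkhoff--Kakutani theorem: cut the word around its middle
  factor, so that both outer parts carry at most half of the weight.\<close>

lemma list_mult_subset:
  "x \<in> list_mult U ns \<Longrightarrow> dyadic_weight ns < (1 / 2) ^ k \<Longrightarrow> x \<in> U k"
proof (induction "length ns" arbitrary: ns x k rule: less_induct)
  case less
  show ?case
  proof (cases "ns = []")
    case True
    then show ?thesis using less.prems U_one by simp
  next
    case False
    obtain as b cs where ns: "ns = as @ b # cs" "dyadic_weight as \<le> dyadic_weight ns / 2"
      "dyadic_weight ns / 2 \<le> dyadic_weight as + (1 / 2) ^ b"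
      using sum_list_split_at[of "\<lambda>n. (1 / 2) ^ n" ns "dyadic_weight ns / 2",
          folded dyadic_weight_def] False dyadic_weight_nonneg[of ns] by force
    obtain a u c where x: "x = a \<otimes> (u \<otimes> c)" "a \<in> list_mult U as" "u \<in> U b" "c \<in> list_mult U cs"
      using less.prems(1) unfolding ns(1) list_mult_append by (auto simp: set_mult_def)
    have "dyadic_weight as < (1 / 2) ^ Suc k" "dyadic_weight cs < (1 / 2) ^ Suc k"
      using ns less.prems(2) by auto
    then have a: "a \<in> U (Suc k)" and c: "c \<in> U (Suc k)"
      using less.hyps[of as a "Suc k"] less.hyps[of cs c "Suc k"] x ns(1) by auto
    \<comment> \<open>The middle letter cannot be halved, but it weighs strictly less than
      \<open>(1 / 2) ^ k\<close>, and the next smaller weight is already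
      \<open>(1 / 2) ^ Suc k\<close>.\<close>
    have "(1 / 2 :: real) ^ b < (1 / 2) ^ k"
      using less.prems(2) dyadic_weight_nonneg[of as] dyadic_weight_nonneg[of cs]
      unfolding ns(1) dyadic_weight_simps by linarith
    then have "Suc k \<le> b" by (simp add: power_strict_decreasing_iff Suc_le_eq)
    then have u: "u \<in> U (Suc k)" using U_antimono x(3) by blast
    show ?thesis
      using U_triple[OF a u c] x(1) a u c U_carrier by (metis m_assoc subsetD)
  qed
qed

text \<open>This is the largest group seminorm that is at most \<open>(1 / 2) ^ k\<close> on every
  \<open>U k\<close>.\<close>

definition chain_norm :: "'a \<Rightarrow> real" where
  "chain_norm x = (INF ns \<in> {ns. x \<in> list_mult U ns}. dyadic_weight ns)"

lemma carrier_list_mult: "x \<in> carrier G \<Longrightarrow> x \<in> list_mult U [0]"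
  by (auto simp: set_mult_def U_0)

lemma chain_norm_le: "x \<in> list_mult U ns \<Longrightarrow> chain_norm x \<le> dyadic_weight ns"
  unfolding chain_norm_def
  by (rule cINF_lower) (auto intro!: bdd_belowI[of _ 0] simp: dyadic_weight_nonneg)

lemma chain_norm_near:
  assumes "x \<in> carrier G" "chain_norm x < c"
  obtains ns where "x \<in> list_mult U ns" "dyadic_weight ns < c"
proof -
  have "{ns. x \<in> list_mult U ns} \<noteq> {}" using carrier_list_mult[OF assms(1)] by blast
  moreover have "bdd_below (dyadic_weight ` {ns. x \<in> list_mult U ns})"
    by (auto intro!: bdd_belowI[of _ 0] simp: dyadic_weight_nonneg)
  ultimately show ?thesis
    using assms(2) that unfolding chain_norm_def by (auto simp: cINF_less_iff)
qed

lemma chain_norm_le_1: "x \<in> carrier G \<Longrightarrow> chain_norm x \<le> 1"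
  using chain_norm_le[OF carrier_list_mult] by simp

lemma chain_norm_nonneg: "x \<in> carrier G \<Longrightarrow> 0 \<le> chain_norm x"
  using chain_norm_near[of x 0] dyadic_weight_nonneg by (metis linorder_not_less)

lemma chain_norm_one: "chain_norm \<one> = 0"
  using chain_norm_le[of \<one> "[]"] chain_norm_nonneg[of \<one>] by simp

lemma chain_norm_inv:
  assumes "x \<in> carrier G" shows "chain_norm (inv x) = chain_norm x"
proof -
  have "inv x \<in> list_mult U ns \<longleftrightarrow> x \<in> list_mult U ns" for ns
    using list_mult_inv[of x ns] list_mult_inv[of "inv x" ns] assms by auto
  then show ?thesis by (simp add: chain_norm_def)
qed

lemma chain_norm_mult:
  assumes x: "x \<in> carrier G" and y: "y \<in> carrier G"
  shows "chain_norm (x \<otimes> y) \<le> chain_norm x + chain_norm y"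
proof (rule field_le_epsilon)
  fix e :: real assume "e > 0"
  obtain ms where ms: "x \<in> list_mult U ms" "dyadic_weight ms < chain_norm x + e / 2"
    using chain_norm_near[OF x, of "chain_norm x + e / 2"] \<open>e > 0\<close> by auto
  obtain ns where ns: "y \<in> list_mult U ns" "dyadic_weight ns < chain_norm y + e / 2"
    using chain_norm_near[OF y, of "chain_norm y + e / 2"] \<open>e > 0\<close> by auto
  have "x \<otimes> y \<in> list_mult U (ms @ ns)"
    using ms ns by (auto simp: list_mult_append set_mult_def)
  then show "chain_norm (x \<otimes> y) \<le> chain_norm x + chain_norm y + e"
    using chain_norm_le[of "x \<otimes> y" "ms @ ns"] ms ns by simp
qed

text \<open>Together with \<open>mem_U_if_chain_norm_less\<close> this traps \<open>U k\<close>
  between two balls around \<open>\<one>\<close>, which later identifies the norm topology with the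
  given one.\<close>

lemma chain_norm_le_power:
  assumes "x \<in> U k" shows "chain_norm x \<le> (1 / 2) ^ k"
proof -
  have "x \<in> list_mult U [k]" using assms U_carrier by (force simp: set_mult_def)
  then show ?thesis using chain_norm_le by fastforce
qed

lemma mem_U_if_chain_norm_less:
  assumes "x \<in> carrier G" "chain_norm x < (1 / 2) ^ k" shows "x \<in> U k"
  using chain_norm_near[OF assms] list_mult_subset by metis

end

section \<open>Neighbourhood chains at the identity of a metrizable group\<close>

text \<open>Continuity of multiplication at the identity is used twice: products from
  \<open>B\<close> land in \<open>A\<close>, products from \<open>A\<close> land in
  \<open>W\<close>. Intersecting with the preimage under inversion makes the result
  symmetric.\<close>

lemma (in topological_group) nbhd_one_triple:
  assumes W: "openin T W" "\<one> \<in> W"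
  obtains V where "openin T V" "\<one> \<in> V" "\<And>x. x \<in> V \<Longrightarrow> inv x \<in> V"
    "\<And>x y z. x \<in> V \<Longrightarrow> y \<in> V \<Longrightarrow> z \<in> V \<Longrightarrow> x \<otimes> y \<otimes> z \<in> W"
proof -
  have double: "\<exists>V. openin T V \<and> \<one> \<in> V \<and> (\<forall>x\<in>V. \<forall>y\<in>V. x \<otimes> y \<in> W)"
    if W: "openin T W" "\<one> \<in> W" for W
  proof -
    define P where "P = {p \<in> topspace (prod_topology T T). (case p of (x, y) \<Rightarrow> x \<otimes> y) \<in> W}"
    have "openin (prod_topology T T) P"
      unfolding P_def by (rule openin_continuous_map_preimage[OF continuous_mult W(1)])
    moreover have "(\<one>, \<one>) \<in> P" using W(2) by (simp add: P_def topspace_eq_carrier)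
    ultimately obtain A B where "openin T A" "openin T B" "\<one> \<in> A" "\<one> \<in> B" "A \<times> B \<subseteq> P"
      using openin_prod_topology_alt[of T T P] by meson
    moreover have "x \<otimes> y \<in> W" if "x \<in> A" "y \<in> B" for x y
      using subsetD[OF \<open>A \<times> B \<subseteq> P\<close>, of "(x, y)"] that by (simp add: P_def)
    ultimately show ?thesis by (intro exI[of _ "A \<inter> B"]) (simp add: openin_Int)
  qed
  obtain A where A: "openin T A" "\<one> \<in> A" "\<And>x y. x \<in> A \<Longrightarrow> y \<in> A \<Longrightarrow> x \<otimes> y \<in> W"
    using double[OF W] by blast
  obtain B where B: "openin T B" "\<one> \<in> B" "\<And>x y. x \<in> B \<Longrightarrow> y \<in> B \<Longrightarrow> x \<otimes> y \<in> A"
    using double[OF A(1,2)] by blast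
  let ?I = "\<lambda>S. {x \<in> topspace T. inv x \<in> S}"
  have "openin T (A \<inter> B)" using A B by blast
  then have "openin T (?I (A \<inter> B))" by (rule openin_continuous_map_preimage[OF continuous_inv])
  then have "openin T (A \<inter> B \<inter> ?I (A \<inter> B))" using A B by blast
  then show ?thesis
  proof (rule that)
    show "\<one> \<in> A \<inter> B \<inter> ?I (A \<inter> B)" using A B by (simp add: topspace_eq_carrier)
    show "inv x \<in> A \<inter> B \<inter> ?I (A \<inter> B)" if "x \<in> A \<inter> B \<inter> ?I (A \<inter> B)" for x
      using that by (simp add: topspace_eq_carrier)
    show "x \<otimes> y \<otimes> z \<in> W"
      if "x \<in> A \<inter> B \<inter> ?I (A \<inter> B)" "y \<in> A \<inter> B \<inter> ?I (A \<inter> B)" "z \<in> A \<inter> B \<inter> ?I (A \<inter> B)"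
      for x y z
      using that A(3) B(3) by blast
  qed
qed

lemma (in topological_group) ex_group_nbhd_chain:
  assumes "comm_group G" and metrizable: "metrizable_space T"
  obtains U where "group_nbhd_chain G U" "\<And>n. openin T (U n)"
    "\<And>W. openin T W \<Longrightarrow> \<one> \<in> W \<Longrightarrow> \<exists>n. U n \<subseteq> W"
proof -
  interpret comm_group G by fact
  obtain M d where M: "Metric_space M d" "T = Metric_space.mtopology M d"
    using metrizable by (auto simp: metrizable_space_def)
  then have "M = carrier G"
    using topspace_eq_carrier Metric_space.topspace_mtopology by metis
  then interpret Metric_space "carrier G" d using M by simp
  have T: "T = mtopology" using M \<open>M = carrier G\<close> by simp
  define P where "P n V \<longleftrightarrow> openin T V \<and> \<one> \<in> V \<and> (\<forall>x\<in>V. inv x \<in> V) \<and> (n = 0 \<longrightarrow> V = carrier G)"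
    for n :: nat and V
  \<comment> \<open>The second conjunct forces the chain to be a neighbourhood base: two factors
    \<open>\<one>\<close> turn it into an inclusion in the ball. Both conjuncts come from one use of
    \<open>nbhd_one_triple\<close> for the intersection of \<open>V\<close> with that ball.\<close>
  define Q where "Q n V V' \<longleftrightarrow> (\<forall>x\<in>V'. \<forall>y\<in>V'. \<forall>z\<in>V'. x \<otimes> y \<otimes> z \<in> V) \<and>
    (\<forall>x\<in>V'. \<forall>y\<in>V'. \<forall>z\<in>V'. x \<otimes> y \<otimes> z \<in> mball \<one> (inverse (Suc n)))" for n V V'
  have "\<exists>U. \<forall>n. P n (U n) \<and> Q n (U n) (U (Suc n))"
  proof (rule dependent_nat_choice)
    show "\<exists>V. P 0 V"
      using openin_topspace[of T] by (auto simp: P_def topspace_eq_carrier)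
    fix V n assume "P n V"
    then have "openin T (V \<inter> mball \<one> (inverse (Suc n)))" "\<one> \<in> V \<inter> mball \<one> (inverse (Suc n))"
      unfolding P_def T by (simp_all add: openin_Int)
    then show "\<exists>V'. P (Suc n) V' \<and> Q n V V'"
      by (rule nbhd_one_triple) (auto simp: P_def Q_def)
  qed
  then obtain U where P: "\<And>n. P n (U n)" and Q: "\<And>n. Q n (U n) (U (Suc n))" by blast
  have U: "openin T (U n)" "U n \<subseteq> carrier G" "\<one> \<in> U n" for n
    using P[of n] openin_subset[of T "U n"] by (auto simp: P_def topspace_eq_carrier)
  show ?thesis
  proof (rule that)
    show "group_nbhd_chain G U"
      using P Q U by unfold_locales (auto simp: P_def Q_def)
    show "openin T (U n)" for n by (rule U)
    fix W assume "openin T W" "\<one> \<in> W"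
    then obtain e where "e > 0" "mball \<one> e \<subseteq> W"
      unfolding T openin_mtopology by blast
    moreover obtain n where "inverse (real (Suc n)) < e" using reals_Archimedean[OF \<open>e > 0\<close>] by blast
    moreover have "U (Suc n) \<subseteq> mball \<one> (inverse (Suc n))"
    proof
      fix x assume x: "x \<in> U (Suc n)"
      then have "x \<otimes> \<one> \<otimes> \<one> \<in> mball \<one> (inverse (Suc n))"
        using Q[of n] U(3)[of "Suc n"] unfolding Q_def by blast
      then show "x \<in> mball \<one> (inverse (Suc n))" using subsetD[OF U(2) x] by simp
    qed
    ultimately have "U (Suc n) \<subseteq> W" by (force simp: subset_iff)
    then show "\<exists>n. U n \<subseteq> W" ..
  qed
qed

section \<open>Group norms and their invariant metrics\<close>

locale normed_group = comm_group G for G (structure) +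
  fixes N :: "'a \<Rightarrow> real"
  assumes norm_one: "N \<one> = 0"
    and norm_inv: "x \<in> carrier G \<Longrightarrow> N (inv x) = N x"
    and norm_mult: "x \<in> carrier G \<Longrightarrow> y \<in> carrier G \<Longrightarrow> N (x \<otimes> y) \<le> N x + N y"
    and norm_eq_0: "x \<in> carrier G \<Longrightarrow> N x = 0 \<Longrightarrow> x = \<one>"
begin

lemma norm_nonneg: "x \<in> carrier G \<Longrightarrow> 0 \<le> N x"
  using norm_mult[of x "inv x"] by (simp add: norm_inv norm_one)

text \<open>Zero off the carrier, since \<open>Metric_space\<close> requires a globally nonnegative symmetric function.\<close>

definition norm_dist :: "'a \<Rightarrow> 'a \<Rightarrow> real" where
  "norm_dist x y = (if x \<in> carrier G \<and> y \<in> carrier G then N (x \<otimes> inv y) else 0)"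

lemma Metric_space_norm_dist: "Metric_space (carrier G) norm_dist"
proof
  show "0 \<le> norm_dist x y" for x y by (simp add: norm_dist_def norm_nonneg)
  have "N (x \<otimes> inv y) = N (y \<otimes> inv x)" if "x \<in> carrier G" "y \<in> carrier G" for x y
    using norm_inv[of "x \<otimes> inv y"] that by (simp add: inv_mult m_comm)
  then show "norm_dist x y = norm_dist y x" for x y
    by (simp add: norm_dist_def)
  fix x y assume xy: "x \<in> carrier G" "y \<in> carrier G"
  show "norm_dist x y = 0 \<longleftrightarrow> x = y"
  proof
    assume "norm_dist x y = 0"
    then have "x \<otimes> inv y = \<one>" using norm_eq_0[of "x \<otimes> inv y"] xy by (simp add: norm_dist_def)
    then show "x = y" using inv_equality xy by fastforce
  qed (use xy in \<open>simp add: norm_dist_def norm_one\<close>)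
  fix z assume z: "z \<in> carrier G"
  have "inv y \<otimes> (y \<otimes> inv z) = inv z" using xy z by (simp add: m_assoc[symmetric])
  then have "x \<otimes> inv z = (x \<otimes> inv y) \<otimes> (y \<otimes> inv z)" using xy z by (simp add: m_assoc)
  then show "norm_dist x z \<le> norm_dist x y + norm_dist y z"
    using norm_mult[of "x \<otimes> inv y" "y \<otimes> inv z"] xy z by (simp add: norm_dist_def)
qed

end

text \<open>The given metric need not be invariant, so only its topology is used. At the identity
  the norm balls and the sets \<open>U n\<close> are cofinal in each other, and translations carry
  this to every point.\<close>

theorem (in topological_group) Birkhoff_Kakutani:
  assumes "comm_group G" and "metrizable_space T"
  obtains N where "normed_group G N" "\<And>x. x \<in> carrier G \<Longrightarrow> N x \<le> 1"
    "T = Metric_space.mtopology (carrier G) (normed_group.norm_dist G N)"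
proof -
  interpret comm_group G by fact
  obtain U where chain: "group_nbhd_chain G U" and U_open: "\<And>n. openin T (U n)"
    and U_base: "\<And>W. openin T W \<Longrightarrow> \<one> \<in> W \<Longrightarrow> \<exists>n. U n \<subseteq> W"
    using ex_group_nbhd_chain[OF assms] by blast
  interpret group_nbhd_chain G U by (rule chain)
  have norm_eq_0: "x = \<one>" if x: "x \<in> carrier G" "chain_norm x = 0" for x
  proof (rule ccontr)
    assume "x \<noteq> \<one>"
    moreover have "t1_space T" using assms(2) metrizable_imp_t1_space by blast
    ultimately obtain W where W: "openin T W" "\<one> \<in> W" "x \<notin> W"
      using x(1) unfolding t1_space_def topspace_eq_carrier by (metis one_closed)
    then obtain n where "U n \<subseteq> W" using U_base by blast
    moreover have "x \<in> U n" using x by (intro mem_U_if_chain_norm_less) auto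
    ultimately show False using W(3) by blast
  qed
  interpret normed_group G chain_norm
    by unfold_locales (auto simp: chain_norm_one chain_norm_inv chain_norm_mult norm_eq_0)
  interpret Metric_space "carrier G" norm_dist by (rule Metric_space_norm_dist)
  have translate: "openin T {y \<in> carrier G. y \<otimes> a \<in> W}" if "openin T W" "a \<in> carrier G" for W a
  proof -
    have "continuous_map T (prod_topology T T) (\<lambda>y. (y, a))"
      using that(2) by (simp add: continuous_map_pairwise o_def topspace_eq_carrier)
    then have "continuous_map T T (\<lambda>y. y \<otimes> a)"
      using continuous_map_compose[OF _ continuous_mult] by (fastforce simp: o_def)
    from openin_continuous_map_preimage[OF this that(1)] show ?thesis
      by (simp add: topspace_eq_carrier)
  qed
  have "openin T W \<longleftrightarrow> openin mtopology W" for W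
  proof
    assume W: "openin T W"
    show "openin mtopology W"
      unfolding openin_mtopology
    proof (intro conjI allI impI)
      show "W \<subseteq> carrier G" using openin_subset[OF W] by (simp add: topspace_eq_carrier)
      fix x assume x: "x \<in> W"
      then have xG: "x \<in> carrier G" using \<open>W \<subseteq> carrier G\<close> by blast
      obtain n where n: "U n \<subseteq> {y \<in> carrier G. y \<otimes> x \<in> W}"
        using U_base[OF translate[OF W xG]] x xG by auto
      have "y \<in> W" if "y \<in> mball x ((1 / 2) ^ n)" for y
      proof -
        have y: "y \<in> carrier G" "chain_norm (y \<otimes> inv x) < (1 / 2) ^ n"
          using that xG commute[of x y] by (auto simp: norm_dist_def)
        then have "y \<otimes> inv x \<in> U n" using xG by (intro mem_U_if_chain_norm_less m_closed inv_closed)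
        then have "y \<otimes> inv x \<otimes> x \<in> W" using n by blast
        then show ?thesis using xG y(1) by (simp add: m_assoc)
      qed
      then have "mball x ((1 / 2) ^ n) \<subseteq> W" by blast
      then show "\<exists>r>0. mball x r \<subseteq> W" by (intro exI[of _ "(1 / 2) ^ n"]) simp
    qed
  next
    assume W: "openin mtopology W"
    show "openin T W"
    proof (subst openin_subopen, intro ballI)
      fix x assume "x \<in> W"
      then obtain r where r: "r > 0" "mball x r \<subseteq> W" and xG: "x \<in> carrier G"
        using W unfolding openin_mtopology by blast
      obtain n where n: "(1 / 2) ^ n < r" using real_arch_pow_inv[of r "1 / 2"] r by auto
      let ?V = "{y \<in> carrier G. y \<otimes> inv x \<in> U n}"
      have "openin T ?V" using translate[OF U_open] xG by simp
      moreover have "x \<in> ?V" using xG U_one by simp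
      moreover have "?V \<subseteq> mball x r"
      proof
        fix y assume "y \<in> ?V"
        then have y: "y \<in> carrier G" "chain_norm (y \<otimes> inv x) < r"
          using chain_norm_le_power[of "y \<otimes> inv x" n] n by auto
        then show "y \<in> mball x r" using xG commute[of x y] by (simp add: norm_dist_def)
      qed
      ultimately show "\<exists>V. openin T V \<and> x \<in> V \<and> V \<subseteq> W" using r by blast
    qed
  qed
  then have "T = mtopology" by (simp add: topology_eq)
  then show ?thesis using that[OF normed_group_axioms chain_norm_le_1] by simp
qed

section \<open>Completion of a seminormed abelian group\<close>

lemma topological_group_invariant_metric:
  fixes H (structure)
  assumes "comm_group H" and "Metric_space (carrier H) d"
    and invariant: "\<And>x y z. x \<in> carrier H \<Longrightarrow> y \<in> carrier H \<Longrightarrow> z \<in> carrier H \<Longrightarrow>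
      d (x \<otimes> z) (y \<otimes> z) \<le> d x y"
  shows "topological_group H (Metric_space.mtopology (carrier H) d)"
proof -
  interpret comm_group H by fact
  interpret Metric_space "carrier H" d by fact
  have mult: "d (x \<otimes> y) (x' \<otimes> y') \<le> d x x' + d y y'"
    if "x \<in> carrier H" "y \<in> carrier H" "x' \<in> carrier H" "y' \<in> carrier H" for x y x' y'
    using triangle[of "x \<otimes> y" "x' \<otimes> y" "x' \<otimes> y'"] invariant[of x x' y] invariant[of y y' x'] that
    by (simp add: m_comm)
  have inv: "d (inv x) (inv y) \<le> d x y" if "x \<in> carrier H" "y \<in> carrier H" for x y
  proof -
    \<comment> \<open>Translation by \<open>inv x \<otimes> inv y\<close> exchanges the roles: it
      takes \<open>y\<close> to \<open>inv x\<close> and \<open>x\<close> to \<open>inv y\<close>,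
      so inversion does not increase distances.\<close>
    have "y \<otimes> (inv x \<otimes> inv y) = inv x" "x \<otimes> (inv x \<otimes> inv y) = inv y"
      using that by (metis inv_closed inv_solve_left m_closed m_comm,
          metis inv_closed inv_solve_left m_closed)
    then show ?thesis
      using invariant[of y x "inv x \<otimes> inv y"] that by (simp add: commute)
  qed
  show ?thesis
  proof
    show "topspace mtopology = carrier H" by simp
    show "continuous_map mtopology mtopology (\<lambda>x. inv x)"
      unfolding continuous_map_to_metric
    proof (intro ballI allI impI)
      fix x and e :: real
      assume x: "x \<in> topspace mtopology" and "e > 0"
      have "\<forall>y\<in>mball x e. inv y \<in> mball (inv x) e"
      proof
        fix y assume "y \<in> mball x e"
        then show "inv y \<in> mball (inv x) e" using inv[of x y] by simp
      qed
      then show "\<exists>U. openin mtopology U \<and> x \<in> U \<and> (\<forall>y\<in>U. inv y \<in> mball (inv x) e)"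
        using x \<open>e > 0\<close> by (intro exI[of _ "mball x e"]) auto
    qed
    show "continuous_map (prod_topology mtopology mtopology) mtopology (\<lambda>(x, y). x \<otimes> y)"
      unfolding continuous_map_to_metric
    proof (intro ballI allI impI)
      fix p and e :: real
      assume p: "p \<in> topspace (prod_topology mtopology mtopology)" and "e > 0"
      obtain x y where xy: "p = (x, y)" "x \<in> carrier H" "y \<in> carrier H" using p by auto
      let ?U = "mball x (e / 2) \<times> mball y (e / 2)"
      have "\<forall>q\<in>?U. (case q of (x, y) \<Rightarrow> x \<otimes> y) \<in> mball (x \<otimes> y) e"
      proof
        fix q assume "q \<in> ?U"
        then obtain u v where q: "q = (u, v)" "u \<in> carrier H" "v \<in> carrier H"
          "d x u < e / 2" "d y v < e / 2" by auto
        then show "(case q of (x, y) \<Rightarrow> x \<otimes> y) \<in> mball (x \<otimes> y) e"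
          using mult[of x y u v] xy by auto
      qed
      then show "\<exists>U. openin (prod_topology mtopology mtopology) U \<and> p \<in> U \<and>
          (\<forall>q\<in>U. (case q of (x, y) \<Rightarrow> x \<otimes> y) \<in> mball (case p of (x, y) \<Rightarrow> x \<otimes> y) e)"
        using xy \<open>e > 0\<close> by (intro exI[of _ ?U]) (auto simp: openin_prod_Times_iff)
    qed
  qed
qed

section \<open>Points of the completion and their addition\<close>

locale group_seminorm =
  fixes q :: "'z::ab_group_add \<Rightarrow> real"
  assumes q_zero: "q 0 = 0"
    and q_minus: "q (- n) = q n"
    and q_triangle: "q (m + n) \<le> q m + q n"
begin

text \<open>An element \<open>a\<close> of the completion is encoded by its distance function \<open>m \<mapsto> q (m - a)\<close>. In terms of
  these functions the group operation becomes infimal convolution, since \<open>q (m - (a + b))\<close> is the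
  infimum of \<open>q (j - a) + q (m - j - b)\<close>, and likewise \<open>gap\<close> is the distance.\<close>

definition points :: "('z \<Rightarrow> real) set" where
  "points = {f. (\<forall>m n. f m \<le> q (m - n) + f n) \<and> (\<forall>m n. q (m - n) \<le> f m + f n) \<and>
    (\<forall>e>0. \<exists>n. f n < e)}"

definition point :: "'z \<Rightarrow> 'z \<Rightarrow> real" where
  "point n = (\<lambda>m. q (m - n))"

definition conv :: "('z \<Rightarrow> real) \<Rightarrow> ('z \<Rightarrow> real) \<Rightarrow> 'z \<Rightarrow> real" where
  "conv f g = (\<lambda>m. INF j. f j + g (m - j))"

definition gap :: "('z \<Rightarrow> real) \<Rightarrow> ('z \<Rightarrow> real) \<Rightarrow> real" where
  "gap f g = (INF j. f j + g j)"

lemma q_commute: "q (m - n) = q (n - m)"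
  using q_minus[of "m - n"] by simp

lemma points_lipschitz: "f \<in> points \<Longrightarrow> f m \<le> q (m - n) + f n"
  and points_triangle: "f \<in> points \<Longrightarrow> q (m - n) \<le> f m + f n"
  by (auto simp: points_def)

lemma points_near:
  assumes "f \<in> points" "e > 0" obtains n where "f n < e"
  using assms by (auto simp: points_def)

lemma points_nonneg: "f \<in> points \<Longrightarrow> 0 \<le> f m"
  using points_triangle[of f m m] by (simp add: q_zero)

lemma point_in_points: "point n \<in> points"
proof -
  have "q (m - n) \<le> q (m - k) + q (k - n)" for m n k
    using q_triangle[of "m - k" "k - n"] by simp
  then show ?thesis
    unfolding points_def point_def
    by (auto simp: q_commute[of _ n] q_zero intro!: exI[of _ n]) (metis q_commute)+
qed

lemma gap_bdd: "f \<in> points \<Longrightarrow> g \<in> points \<Longrightarrow> bdd_below (range (\<lambda>j. f j + g j))"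
  by (rule bdd_belowI[of _ 0]) (auto simp: points_nonneg)

lemma conv_bdd: "f \<in> points \<Longrightarrow> g \<in> points \<Longrightarrow> bdd_below (range (\<lambda>j. f j + g (m - j)))"
  by (rule bdd_belowI[of _ 0]) (auto simp: points_nonneg)

lemma gap_le: "f \<in> points \<Longrightarrow> g \<in> points \<Longrightarrow> gap f g \<le> f j + g j"
  unfolding gap_def by (rule cINF_lower[OF gap_bdd]) auto

lemma gap_near:
  assumes "f \<in> points" "g \<in> points" "gap f g < c" obtains j where "f j + g j < c"
  using assms cINF_less_iff[OF _ gap_bdd] unfolding gap_def by blast

lemma conv_le: "f \<in> points \<Longrightarrow> g \<in> points \<Longrightarrow> conv f g (m + n) \<le> f m + g n"
  unfolding conv_def using cINF_lower[OF conv_bdd[of f g "m + n"], of m] by simp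

lemma le_conv:
  assumes "\<And>i j. i + j = m \<Longrightarrow> c \<le> f i + g j" shows "c \<le> conv f g m"
  unfolding conv_def by (rule cINF_greatest) (auto intro: assms)

text \<open>A point satisfies \<open>\<bar>f m - q (m - n)\<bar> \<le> f n\<close>, so an
  \<open>n\<close> at which both points are small forces them to be close everywhere.\<close>

lemma points_eqI:
  assumes f: "f \<in> points" and g: "g \<in> points"
    and near: "\<And>e. e > 0 \<Longrightarrow> \<exists>n. f n < e \<and> g n < e"
  shows "f = g"
proof
  fix m
  have "f m \<le> g m + e \<and> g m \<le> f m + e" if e: "e > 0" for e
  proof -
    obtain n where "f n < e / 2" "g n < e / 2" using near[OF half_gt_zero[OF e]] by blast
    then show ?thesis
      using points_lipschitz[OF f, of m n] points_triangle[OF f, of m n]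
        points_lipschitz[OF g, of m n] points_triangle[OF g, of m n] by linarith
  qed
  then show "f m = g m" by (meson antisym field_le_epsilon)
qed

lemma conv_in_points:
  assumes f: "f \<in> points" and g: "g \<in> points" shows "conv f g \<in> points"
proof -
  have 1: "conv f g m \<le> q (m - n) + conv f g n" for m n
  proof -
    have "conv f g m - q (m - n) \<le> conv f g n"
    proof (rule le_conv)
      fix i j assume n: "i + j = n"
      have "conv f g m \<le> f (i + (m - n)) + g j"
        using conv_le[OF f g, of "i + (m - n)" j] unfolding n[symmetric] by (simp add: algebra_simps)
      also have "f (i + (m - n)) \<le> q (m - n) + f i"
        using points_lipschitz[OF f, of "i + (m - n)" i] by simp
      finally show "conv f g m - q (m - n) \<le> f i + g j" by simp
    qed
    then show ?thesis by simp
  qed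
  have 2: "q (m - n) \<le> conv f g m + conv f g n" for m n
  proof -
    have "q (m - n) - conv f g n \<le> conv f g m"
    proof (rule le_conv)
      fix i j assume m: "i + j = m"
      have "q (m - n) - (f i + g j) \<le> conv f g n"
      proof (rule le_conv)
        fix k l assume n: "k + l = n"
        have "q (m - n) \<le> q (i - k) + q (j - l)"
          using q_triangle[of "i - k" "j - l"] m n by (simp add: algebra_simps)
        then show "q (m - n) - (f i + g j) \<le> f k + g l"
          using points_triangle[OF f, of i k] points_triangle[OF g, of j l] by linarith
      qed
      then show "q (m - n) - conv f g n \<le> f i + g j" by simp
    qed
    then show ?thesis by simp
  qed
  have 3: "\<exists>n. conv f g n < e" if e: "e > 0" for e
  proof -
    obtain m n where "f m < e / 2" "g n < e / 2"
      using points_near[OF f half_gt_zero[OF e]] points_near[OF g half_gt_zero[OF e]] by metis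
    then show ?thesis using conv_le[OF f g, of m n] by (intro exI[of _ "m + n"]) linarith
  qed
  show ?thesis using 1 2 3 by (auto simp: points_def)
qed

text \<open>One inequality suffices: where \<open>f m\<close> and \<open>g n\<close> are small, both
  \<open>conv f g\<close> and \<open>h\<close> are small at \<open>m + n\<close>, and
  \<open>points_eqI\<close> applies. The group laws thus follow without evaluating an
  infimum.\<close>

lemma conv_eqI:
  assumes "f \<in> points" "g \<in> points" "h \<in> points"
    and "\<And>m n. h (m + n) \<le> f m + g n"
  shows "conv f g = h"
proof (rule points_eqI)
  fix e :: real assume "e > 0"
  then have "e / 2 > 0" by simp
  then obtain m n where "f m < e / 2" "g n < e / 2"
    using points_near[OF assms(1)] points_near[OF assms(2)] by metis
  then have "conv f g (m + n) < e \<and> h (m + n) < e"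
    using conv_le[of f g m n] assms(4)[of m n] assms by linarith
  then show "\<exists>n. conv f g n < e \<and> h n < e" ..
qed (use assms conv_in_points in auto)

lemma conv_commute:
  assumes "f \<in> points" "g \<in> points" shows "conv f g = conv g f"
  using assms conv_le[of g f] by (intro conv_eqI conv_in_points) (metis add.commute)+

lemma conv_assoc:
  assumes f: "f \<in> points" and g: "g \<in> points" and h: "h \<in> points"
  shows "conv (conv f g) h = conv f (conv g h)"
proof (rule conv_eqI)
  fix m n
  have "conv f (conv g h) (m + n) - h n \<le> conv f g m"
  proof (rule le_conv)
    fix i j assume m: "i + j = m"
    have "conv f (conv g h) (m + n) \<le> f i + conv g h (j + n)"
      using conv_le[OF f conv_in_points[OF g h], of i "j + n"] m by (simp add: add.assoc[symmetric])
    also have "conv g h (j + n) \<le> g j + h n" by (rule conv_le[OF g h])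
    finally show "conv f (conv g h) (m + n) - h n \<le> f i + g j" by simp
  qed
  then show "conv f (conv g h) (m + n) \<le> conv f g m + h n" by simp
qed (use assms conv_in_points in auto)

lemma conv_point_zero: "f \<in> points \<Longrightarrow> conv (point 0) f = f"
  using points_lipschitz[of f]
  by (intro conv_eqI point_in_points) (auto simp: point_def, metis add_diff_cancel_right')

lemma conv_point: "conv (point m) (point n) = point (m + n)"
proof (rule conv_eqI)
  fix i j
  show "point (m + n) (i + j) \<le> point m i + point n j"
    using q_triangle[of "i - m" "j - n"] by (simp add: point_def algebra_simps)
qed (auto simp: point_in_points)

text \<open>If \<open>f\<close> describes \<open>a\<close>, the reflected function describes
  \<open>- a\<close>; this supplies inverses in the completion.\<close>

lemma reflect_in_points: "f \<in> points \<Longrightarrow> (\<lambda>m. f (- m)) \<in> points"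
proof -
  assume f: "f \<in> points"
  have q: "q (m - n) = q (- m - - n)" for m n
    using q_commute[of m n] by simp
  have "f (- m) \<le> q (m - n) + f (- n)" "q (m - n) \<le> f (- m) + f (- n)" for m n
    unfolding q[of m n] by (rule points_lipschitz[OF f], rule points_triangle[OF f])
  moreover have "\<exists>n. f (- n) < e" if e: "e > 0" for e
    using points_near[OF f that] by (metis minus_minus)
  ultimately show ?thesis by (auto simp: points_def)
qed

lemma conv_reflect: "f \<in> points \<Longrightarrow> conv (\<lambda>m. f (- m)) f = point 0"
proof (rule conv_eqI)
  fix m n assume "f \<in> points"
  then have "q (n - - m) \<le> f n + f (- m)" by (rule points_triangle)
  then show "point 0 (m + n) \<le> f (- m) + f n" by (simp add: point_def add.commute)
qed (auto simp: point_in_points reflect_in_points)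

section \<open>The metric of the completion\<close>

lemma gap_nonneg: "f \<in> points \<Longrightarrow> g \<in> points \<Longrightarrow> 0 \<le> gap f g"
  unfolding gap_def by (rule cINF_greatest) (auto simp: points_nonneg)

lemma gap_commute: "gap f g = gap g f"
  by (simp add: gap_def add.commute)

lemma gap_triangle:
  assumes f: "f \<in> points" and g: "g \<in> points" and h: "h \<in> points"
  shows "gap f h \<le> gap f g + gap g h"
proof (rule field_le_epsilon)
  fix e :: real assume "e > 0"
  obtain j where j: "f j + g j < gap f g + e / 2"
    using gap_near[OF f g, of "gap f g + e / 2"] \<open>e > 0\<close> by auto
  obtain k where k: "g k + h k < gap g h + e / 2"
    using gap_near[OF g h, of "gap g h + e / 2"] \<open>e > 0\<close> by auto
  have "gap f h \<le> f j + h j" by (rule gap_le[OF f h])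
  also have "h j \<le> q (j - k) + h k" by (rule points_lipschitz[OF h])
  also have "q (j - k) \<le> g j + g k" by (rule points_triangle[OF g])
  finally show "gap f h \<le> gap f g + gap g h + e" using j k by linarith
qed

lemma gap_eq_0_iff:
  assumes f: "f \<in> points" and g: "g \<in> points"
  shows "gap f g = 0 \<longleftrightarrow> f = g"
proof
  assume 0: "gap f g = 0"
  show "f = g"
  proof (rule points_eqI[OF f g])
    fix e :: real assume "e > 0"
    then obtain j where "f j + g j < e" using gap_near[OF f g] 0 by metis
    then show "\<exists>n. f n < e \<and> g n < e"
      using points_nonneg[OF f, of j] points_nonneg[OF g, of j] by (intro exI[of _ j]) auto
  qed
next
  assume "f = g"
  have "gap f f \<le> e" if e: "e > 0" for e
  proof -
    obtain n where "f n < e / 2" using points_near[OF f half_gt_zero[OF e]] by blast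
    then show ?thesis using gap_le[OF f f, of n] by linarith
  qed
  then show "gap f g = 0"
    using gap_nonneg[OF f f] \<open>f = g\<close> by (metis antisym add_0 field_le_epsilon)
qed

lemma gap_conv_le:
  assumes f: "f \<in> points" and g: "g \<in> points" and h: "h \<in> points"
  shows "gap (conv f h) (conv g h) \<le> gap f g"
proof (rule field_le_epsilon)
  fix e :: real assume "e > 0"
  obtain j where j: "f j + g j < gap f g + e / 2"
    using gap_near[OF f g, of "gap f g + e / 2"] \<open>e > 0\<close> by auto
  obtain k where k: "h k < e / 4" using points_near[OF h, of "e / 4"] \<open>e > 0\<close> by (meson divide_pos_pos zero_less_numeral)
  have "gap (conv f h) (conv g h) \<le> conv f h (j + k) + conv g h (j + k)"
    by (intro gap_le conv_in_points f g h)
  also have "\<dots> \<le> (f j + h k) + (g j + h k)"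
    by (intro add_mono conv_le f g h)
  finally show "gap (conv f h) (conv g h) \<le> gap f g + e" using j k by linarith
qed

lemma gap_point: "f \<in> points \<Longrightarrow> gap f (point n) \<le> f n"
  using gap_le[OF _ point_in_points, of f n n] by (simp add: point_def q_zero)

text \<open>A Cauchy sequence for \<open>gap\<close> is therefore uniformly Cauchy as a sequence of
  functions, which provides the candidate limit in \<open>gap_complete\<close>.\<close>

lemma abs_diff_le_gap:
  assumes f: "f \<in> points" and g: "g \<in> points"
  shows "\<bar>f m - g m\<bar> \<le> gap f g"
proof (rule field_le_epsilon)
  fix e :: real assume "e > 0"
  then obtain n where n: "f n + g n < gap f g + e" using gap_near[OF f g, of "gap f g + e"] by auto
  then show "\<bar>f m - g m\<bar> \<le> gap f g + e"
    using points_lipschitz[OF f, of m n] points_triangle[OF f, of m n]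
      points_lipschitz[OF g, of m n] points_triangle[OF g, of m n] by linarith
qed

lemma gap_complete:
  fixes s :: "nat \<Rightarrow> 'z \<Rightarrow> real"
  assumes s: "\<And>i. s i \<in> points"
    and Cauchy: "\<And>e. e > 0 \<Longrightarrow> \<exists>N. \<forall>i\<ge>N. \<forall>j\<ge>N. gap (s i) (s j) < e"
  obtains f where "f \<in> points" "\<And>e. e > 0 \<Longrightarrow> \<exists>N. \<forall>i\<ge>N. gap (s i) f < e"
proof -
  have "Cauchy (\<lambda>i. s i m)" for m
    unfolding Cauchy_def dist_real_def
    using Cauchy abs_diff_le_gap[OF s s] by (meson le_less_trans)
  then have "\<exists>l. (\<lambda>i. s i m) \<longlonglongrightarrow> l" for m
    by (simp add: Cauchy_convergent_iff convergent_def)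
  then obtain f where f: "\<And>m. (\<lambda>i. s i m) \<longlonglongrightarrow> f m" by metis
  have 1: "f m \<le> q (m - n) + f n" for m n
    by (rule LIMSEQ_le[OF f tendsto_add[OF tendsto_const f]]) (use points_lipschitz[OF s] in auto)
  have 2: "q (m - n) \<le> f m + f n" for m n
    by (rule LIMSEQ_le_const[OF tendsto_add[OF f f]]) (use points_triangle[OF s] in auto)
  \<comment> \<open>The two inequalities defining \<open>points\<close> survive pointwise limits,
    but the existence of small values does not. The bound obtained here is uniform in
    \<open>m\<close>, so small values of some \<open>s i\<close> pass to \<open>f\<close>.\<close>
  have near: "f m \<le> s i m + e" if "\<forall>i\<ge>N. \<forall>j\<ge>N. gap (s i) (s j) < e" "i \<ge> N" for m i N e
  proof (rule LIMSEQ_le_const2[OF f])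
    have "s j m \<le> s i m + e" if "j \<ge> N" for j
      using abs_diff_le_gap[OF s s, of i m j] \<open>\<forall>i\<ge>N. \<forall>j\<ge>N. gap (s i) (s j) < e\<close> \<open>i \<ge> N\<close> that
      by fastforce
    then show "\<exists>N. \<forall>j\<ge>N. s j m \<le> s i m + e" by blast
  qed
  have 3: "\<exists>n. f n < e" if e: "e > 0" for e
  proof -
    obtain N where N: "\<forall>i\<ge>N. \<forall>j\<ge>N. gap (s i) (s j) < e / 2" using Cauchy[OF half_gt_zero[OF e]] by blast
    obtain n where "s N n < e / 2" using points_near[OF s half_gt_zero[OF e]] by blast
    then show ?thesis using near[OF N order_refl, of n] by (intro exI[of _ n]) linarith
  qed
  have f_points: "f \<in> points" using 1 2 3 by (auto simp: points_def)
  show ?thesis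
  proof (rule that[OF f_points])
    fix e :: real assume "e > 0"
    then obtain N where N: "\<forall>i\<ge>N. \<forall>j\<ge>N. gap (s i) (s j) < e / 4" using Cauchy[of "e / 4"] by fastforce
    have "gap (s i) f < e" if "i \<ge> N" for i
    proof -
      obtain n where "s i n < e / 4" using points_near[OF s, of "e / 4"] \<open>e > 0\<close> by (meson divide_pos_pos zero_less_numeral)
      then show ?thesis using near[OF N that, of n] gap_le[OF s f_points, of i n] \<open>e > 0\<close> by linarith
    qed
    then show "\<exists>N. \<forall>i\<ge>N. gap (s i) f < e" by blast
  qed
qed

text \<open>The completion has its elements encoded in another type by an injection \<open>code\<close>. A value of
  \<open>Metric_space\<close> must be nonnegative off the carrier too, hence the absolute value.\<close>

definition completion :: "(('z \<Rightarrow> real) \<Rightarrow> 'c) \<Rightarrow> 'c monoid" where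
  "completion code = \<lparr>carrier = code ` points,
    mult = (\<lambda>a b. code (conv (the_inv code a) (the_inv code b))), one = code (point 0)\<rparr>"

definition completion_dist :: "(('z \<Rightarrow> real) \<Rightarrow> 'c) \<Rightarrow> 'c \<Rightarrow> 'c \<Rightarrow> real" where
  "completion_dist code a b = \<bar>gap (the_inv code a) (the_inv code b)\<bar>"

context
  fixes code :: "('z \<Rightarrow> real) \<Rightarrow> 'c"
  assumes code: "inj code"
begin

lemma the_inv_code [simp]: "the_inv code (code f) = f"
  using code by (simp add: the_inv_f_f)

lemma comm_group_completion: "comm_group (completion code)"
proof (rule comm_groupI)
  fix x assume "x \<in> carrier (completion code)"
  then obtain f where f: "x = code f" "f \<in> points" by (auto simp: completion_def)
  then show "\<one>\<^bsub>completion code\<^esub> \<otimes>\<^bsub>completion code\<^esub> x = x"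
    by (simp add: completion_def conv_point_zero)
  show "\<exists>y\<in>carrier (completion code). y \<otimes>\<^bsub>completion code\<^esub> x = \<one>\<^bsub>completion code\<^esub>"
    using f conv_reflect[of f] reflect_in_points[of f]
    by (intro bexI[of _ "code (\<lambda>m. f (- m))"]) (simp_all add: completion_def)
  fix y assume "y \<in> carrier (completion code)"
  then obtain g where g: "y = code g" "g \<in> points" by (auto simp: completion_def)
  with f show "x \<otimes>\<^bsub>completion code\<^esub> y \<in> carrier (completion code)"
    by (simp add: completion_def conv_in_points)
  from f g show "x \<otimes>\<^bsub>completion code\<^esub> y = y \<otimes>\<^bsub>completion code\<^esub> x"
    by (simp add: completion_def) (metis conv_commute)
  fix z assume "z \<in> carrier (completion code)"
  then obtain h where "z = code h" "h \<in> points" by (auto simp: completion_def)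
  with f g show "x \<otimes>\<^bsub>completion code\<^esub> y \<otimes>\<^bsub>completion code\<^esub> z =
      x \<otimes>\<^bsub>completion code\<^esub> (y \<otimes>\<^bsub>completion code\<^esub> z)"
    by (simp add: completion_def conv_assoc)
next
  show "\<one>\<^bsub>completion code\<^esub> \<in> carrier (completion code)"
    by (simp add: completion_def point_in_points)
qed

lemma Metric_space_completion: "Metric_space (carrier (completion code)) (completion_dist code)"
proof
  fix x y z
  assume "x \<in> carrier (completion code)" "y \<in> carrier (completion code)"
    "z \<in> carrier (completion code)"
  then show "completion_dist code x z \<le> completion_dist code x y + completion_dist code y z"
    by (auto simp: completion_def completion_dist_def gap_nonneg gap_triangle)
qed (auto simp: completion_def completion_dist_def gap_commute gap_eq_0_iff)

interpretation comp: Metric_space "carrier (completion code)" "completion_dist code"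
  by (rule Metric_space_completion)

lemma topological_group_completion: "topological_group (completion code) comp.mtopology"
  by (rule topological_group_invariant_metric[OF comm_group_completion Metric_space_completion])
    (auto simp: completion_def completion_dist_def gap_nonneg conv_in_points gap_conv_le)

lemma completely_metrizable_completion: "completely_metrizable_space comp.mtopology"
proof (rule comp.completely_metrizable_space_mtopology)
  show "comp.mcomplete"
    unfolding comp.mcomplete_def
  proof (intro allI impI)
    fix x assume x: "comp.MCauchy x"
    then have "range x \<subseteq> code ` points"
      unfolding comp.MCauchy_def by (simp add: completion_def)
    then have "\<forall>i. \<exists>f. f \<in> points \<and> x i = code f" by auto
    then obtain s where s: "\<And>i. s i \<in> points" "\<And>i. x i = code (s i)" by metis
    have dist: "completion_dist code (code f) (code g) = gap f g" if "f \<in> points" "g \<in> points" for f g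
      using that by (simp add: completion_dist_def gap_nonneg)
    have "\<exists>N. \<forall>i\<ge>N. \<forall>j\<ge>N. gap (s i) (s j) < e" if e: "e > 0" for e
      using x that s(1) unfolding comp.MCauchy_def s(2) by (fastforce simp: dist)
    then obtain f where f: "f \<in> points" "\<And>e. e > 0 \<Longrightarrow> \<exists>N. \<forall>i\<ge>N. gap (s i) f < e"
      using gap_complete[of s, OF s(1)] by blast
    show "\<exists>l. limitin comp.mtopology x l sequentially"
      unfolding comp.limit_metric_sequentially s(2)
      using s(1) f by (intro exI[of _ "code f"]) (auto simp: dist completion_def)
  qed
qed

end

end

text \<open>The powers of \<open>code (point 1)\<close> are the images of all integers. They are
  dense because \<open>f n\<close> bounds the distance from \<open>f\<close> to
  \<open>point n\<close>, and a point takes arbitrarily small values.\<close>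

lemma monothetic_completion:
  fixes q :: "int \<Rightarrow> real" and code :: "(int \<Rightarrow> real) \<Rightarrow> 'c"
  assumes "group_seminorm q" and code: "inj code"
  defines "H \<equiv> group_seminorm.completion q code"
  shows "monothetic H (Metric_space.mtopology (carrier H) (group_seminorm.completion_dist code))"
proof -
  interpret group_seminorm q by fact
  interpret H: comm_group H unfolding H_def by (rule comm_group_completion[OF code])
  interpret comp: Metric_space "carrier H" "completion_dist code"
    unfolding H_def by (rule Metric_space_completion[OF code])
  let ?g = "code (point 1)"
  have the_inv_code: "the_inv code (code f) = f" for f using code by (simp add: the_inv_f_f)
  have g: "?g \<in> carrier H" by (auto simp: H_def completion_def point_in_points)
  have mult: "code (point m) \<otimes>\<^bsub>H\<^esub> code (point n) = code (point (m + n))" for m n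
    by (simp add: H_def completion_def the_inv_code conv_point)
  have one: "\<one>\<^bsub>H\<^esub> = code (point 0)" by (simp add: H_def completion_def)
  have inv_g: "inv\<^bsub>H\<^esub> ?g = code (point (- 1))"
    using H.inv_equality[of "code (point (- 1))" ?g]
    by (simp add: mult one g) (simp add: H_def completion_def point_in_points)
  have gen: "code (point n) \<in> generate H {?g}" for n
  proof (induction n rule: int_induct[of _ 0])
    case base
    then show ?case using generate.one[of H "{?g}"] by (simp add: one)
  next
    case (step1 i)
    then show ?case using generate.eng[OF step1(2) generate.incl[of ?g "{?g}" H]] by (simp add: mult)
  next
    case (step2 i)
    then show ?case using generate.eng[OF step2(2) generate.inv[of ?g "{?g}" H]]
      by (simp add: mult inv_g)
  qed
  have "x \<in> comp.mtopology closure_of generate H {?g}" if x: "x \<in> carrier H" for x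
    unfolding comp.metric_closure_of
  proof (intro CollectI conjI that allI impI)
    fix e :: real assume "e > 0"
    obtain f where f: "x = code f" "f \<in> points" using x by (auto simp: H_def completion_def)
    then obtain n where "f n < e" using points_near \<open>e > 0\<close> by blast
    then have "code (point n) \<in> comp.mball x e"
      using f gap_point[of f n] gap_nonneg[OF f(2) point_in_points, of n] unfolding comp.in_mball
      by (auto simp: completion_dist_def the_inv_code H_def completion_def point_in_points)
    then show "\<exists>y\<in>generate H {?g}. y \<in> comp.mball x e" using gen by blast
  qed
  then show ?thesis
    unfolding monothetic_def using g closure_of_subset_topspace[of comp.mtopology] by force
qed

section \<open>Adjoining a topological generator\<close>

text \<open>A real number is determined by the rationals below it, so such a function amounts to a
  set of pairs from a countable type, that is, a set of naturals; there are as many of those as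
  reals.\<close>

lemma inj_real_valued_functions_to_real:
  obtains code :: "('i::countable \<Rightarrow> real) \<Rightarrow> real" where "inj code"
proof -
  define cuts where "cuts f = to_nat ` {(i, r :: rat). of_rat r < f i}" for f :: "'i \<Rightarrow> real"
  have "inj cuts"
  proof (rule injI)
    fix f g :: "'i \<Rightarrow> real" assume "cuts f = cuts g"
    then have "{(i, r :: rat). of_rat r < f i} = {(i, r :: rat). of_rat r < g i}"
      by (simp add: cuts_def inj_image_eq_iff)
    then have eq: "of_rat r < f i \<longleftrightarrow> of_rat r < g i" for i and r :: rat by auto
    show "f = g"
    proof
      fix i
      show "f i = g i"
        using eq[of _ i] of_rat_dense[of "f i" "g i"] of_rat_dense[of "g i" "f i"]
        by (metis less_asym linorder_less_linear)
    qed
  qed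
  moreover obtain h :: "nat set \<Rightarrow> real" where "inj h"
    using nat_sets_eqpoll_reals by (auto simp: eqpoll_def bij_betw_def)
  ultimately show ?thesis using that inj_compose by blast
qed

section \<open>The seminorm on the group with a free generator adjoined\<close>

text \<open>Approximation by \<open>d k\<close> with arbitrarily late \<open>k\<close> is required
  because \<open>k! z\<close> is only within \<open>1 / (k + 1)\<close> of
  \<open>d k\<close>.\<close>

locale normed_group_sequence = normed_group +
  fixes d :: "nat \<Rightarrow> 'a"
  assumes norm_le_1: "x \<in> carrier G \<Longrightarrow> N x \<le> 1"
    and d_carrier [simp]: "d k \<in> carrier G"
    and d_dense: "x \<in> carrier G \<Longrightarrow> e > 0 \<Longrightarrow> \<exists>k\<ge>M. N (inv x \<otimes> d k) < e"
begin

text \<open>In additive notation the combination of the \<open>k! z - d k\<close> with coefficients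
  \<open>m k\<close>, \<open>k < L\<close>, equals \<open>weight m L\<close> times \<open>z\<close>
  minus \<open>word m L\<close>. Subtracting it from \<open>x + n z\<close> with
  \<open>n = weight m L\<close> leaves \<open>x + word m L\<close>, hence the product in
  \<open>ext_norm\<close>.\<close>

primrec word :: "(nat \<Rightarrow> int) \<Rightarrow> nat \<Rightarrow> 'a" where
  "word m 0 = \<one>"
| "word m (Suc L) = word m L \<otimes> d L [^] m L"

definition weight :: "(nat \<Rightarrow> int) \<Rightarrow> nat \<Rightarrow> int" where
  "weight m L = (\<Sum>k<L. m k * fact k)"

definition cost :: "(nat \<Rightarrow> int) \<Rightarrow> nat \<Rightarrow> real" where
  "cost m L = (\<Sum>k<L. \<bar>of_int (m k)\<bar> / real (Suc k))"

text \<open>\<open>ext_norm x n\<close> is the value at \<open>x + n z\<close> of the largest seminorm on \<open>G \<oplus> \<int>z\<close> that is at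
  most \<open>N\<close> on \<open>G\<close> and at most \<open>1 / (k + 1)\<close> at \<open>k! z - d k\<close>: the infimum runs over the
  decompositions of \<open>x + n z\<close> into an element of \<open>G\<close> and a combination of the \<open>k! z - d k\<close>.\<close>

definition ext_norm :: "'a \<Rightarrow> int \<Rightarrow> real" where
  "ext_norm x n = (INF (m, L) \<in> {(m, L). weight m L = n}. N (x \<otimes> word m L) + cost m L)"

lemma word_carrier [simp]: "word m L \<in> carrier G"
  by (induction L) auto

lemma cost_nonneg: "0 \<le> cost m L"
  by (simp add: cost_def sum_nonneg)

lemma word_add: "word (\<lambda>k. m k + m' k) L = word m L \<otimes> word m' L"
proof (induction L)
  case (Suc L)
  then show ?case
    by (simp add: int_pow_mult[symmetric] m_ac)
qed simp

lemma word_minus: "word (\<lambda>k. - m k) L = inv (word m L)"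
  by (induction L) (simp_all add: int_pow_neg inv_mult)

lemma weight_add: "weight (\<lambda>k. m k + m' k) L = weight m L + weight m' L"
  by (simp add: weight_def distrib_right sum.distrib)

lemma cost_add: "cost (\<lambda>k. m k + m' k) L \<le> cost m L + cost m' L"
  unfolding cost_def sum.distrib[symmetric]
  by (intro sum_mono) (simp add: add_divide_distrib[symmetric] divide_right_mono)

text \<open>Coefficients from index \<open>L\<close> on are arbitrary, so they are set to 0 before
  combinations of different lengths are added.\<close>

definition pad :: "nat \<Rightarrow> (nat \<Rightarrow> int) \<Rightarrow> nat \<Rightarrow> int" where
  "pad L m k = (if k < L then m k else 0)"

lemma word_cong: "(\<And>k. k < L \<Longrightarrow> m k = m' k) \<Longrightarrow> word m L = word m' L"
  by (induction L) auto

lemma word_pad: "L \<le> L' \<Longrightarrow> word (pad L m) L' = word m L"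
proof (induction rule: dec_induct)
  case base
  show ?case by (rule word_cong) (simp add: pad_def)
next
  case (step n)
  then show ?case by (simp add: pad_def)
qed

lemma weight_pad: "L \<le> L' \<Longrightarrow> weight (pad L m) L' = weight m L"
  unfolding weight_def pad_def by (rule sum.mono_neutral_cong_right) auto

lemma cost_pad: "L \<le> L' \<Longrightarrow> cost (pad L m) L' = cost m L"
  unfolding cost_def pad_def by (rule sum.mono_neutral_cong_right) auto

lemma word_sum:
  obtains m'' L'' where "word m'' L'' = word m L \<otimes> word m' L'"
    "weight m'' L'' = weight m L + weight m' L'" "cost m'' L'' \<le> cost m L + cost m' L'"
proof -
  let ?L = "max L L'"
  show ?thesis
    using that[of "\<lambda>k. pad L m k + pad L' m' k" ?L]
      word_add[of "pad L m" "pad L' m'" ?L] weight_add[of "pad L m" "pad L' m'" ?L]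
      cost_add[of "pad L m" "pad L' m'" ?L]
    by (simp add: word_pad weight_pad cost_pad)
qed

lemma ext_norm_bdd:
  "x \<in> carrier G \<Longrightarrow> bdd_below ((\<lambda>(m, L). N (x \<otimes> word m L) + cost m L) ` S)"
  by (rule bdd_belowI[of _ 0]) (auto intro!: add_nonneg_nonneg norm_nonneg cost_nonneg)

lemma ext_norm_le:
  "x \<in> carrier G \<Longrightarrow> ext_norm x (weight m L) \<le> N (x \<otimes> word m L) + cost m L"
  unfolding ext_norm_def using cINF_lower[OF ext_norm_bdd, of x "(m, L)" "{(m', L'). weight m' L' = weight m L}"] by simp

text \<open>As \<open>fact 0 = 1\<close>, index 0 alone realises every integer. The infimum in
  \<open>ext_norm\<close> therefore ranges over a nonempty set.\<close>

lemma ex_weight: "\<exists>m L. weight m L = n"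
  by (intro exI[of _ "\<lambda>_. n"] exI[of _ 1]) (simp add: weight_def)

lemma le_ext_norm:
  assumes "\<And>m L. weight m L = n \<Longrightarrow> c \<le> N (x \<otimes> word m L) + cost m L"
  shows "c \<le> ext_norm x n"
  unfolding ext_norm_def by (rule cINF_greatest) (use assms ex_weight in auto)

lemma ext_norm_near:
  assumes "ext_norm x n < c"
  obtains m L where "weight m L = n" "N (x \<otimes> word m L) + cost m L < c"
  using le_ext_norm[of n c x] assms by force

lemma ext_norm_triangle:
  assumes x: "x \<in> carrier G" and y: "y \<in> carrier G"
  shows "ext_norm (x \<otimes> y) (n + k) \<le> ext_norm x n + ext_norm y k"
proof (rule field_le_epsilon)
  fix e :: real assume "e > 0"
  obtain m L where m: "weight m L = n" "N (x \<otimes> word m L) + cost m L < ext_norm x n + e / 2"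
    using ext_norm_near[of x n "ext_norm x n + e / 2"] \<open>e > 0\<close> by auto
  obtain m' L' where m': "weight m' L' = k"
    "N (y \<otimes> word m' L') + cost m' L' < ext_norm y k + e / 2"
    using ext_norm_near[of y k "ext_norm y k + e / 2"] \<open>e > 0\<close> by auto
  obtain m'' L'' where m'': "word m'' L'' = word m L \<otimes> word m' L'"
    "weight m'' L'' = n + k" "cost m'' L'' \<le> cost m L + cost m' L'"
    using word_sum[of m L m' L'] m m' by metis
  have "x \<otimes> y \<otimes> (word m L \<otimes> word m' L') = (x \<otimes> word m L) \<otimes> (y \<otimes> word m' L')"
    using x y by (simp add: m_ac)
  then show "ext_norm (x \<otimes> y) (n + k) \<le> ext_norm x n + ext_norm y k + e"
    using ext_norm_le[of "x \<otimes> y" m'' L''] norm_mult[of "x \<otimes> word m L" "y \<otimes> word m' L'"]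
      x y m(2) m'(2) m'' by simp
qed

lemma ext_norm_inv_le:
  assumes x: "x \<in> carrier G" shows "ext_norm (inv x) (- n) \<le> ext_norm x n"
proof (rule le_ext_norm)
  fix m L assume "weight m L = n"
  then have "weight (\<lambda>k. - m k) L = - n" by (simp add: weight_def sum_negf)
  moreover have "cost (\<lambda>k. - m k) L = cost m L" by (simp add: cost_def)
  moreover have "N (inv x \<otimes> word (\<lambda>k. - m k) L) = N (x \<otimes> word m L)"
    using norm_inv[of "x \<otimes> word m L"] x by (simp add: word_minus inv_mult)
  ultimately show "ext_norm (inv x) (- n) \<le> N (x \<otimes> word m L) + cost m L"
    using ext_norm_le[of "inv x" "\<lambda>k. - m k" L] x by simp
qed

lemma ext_norm_inv: "x \<in> carrier G \<Longrightarrow> ext_norm (inv x) (- n) = ext_norm x n"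
  using ext_norm_inv_le[of x n] ext_norm_inv_le[of "inv x" "- n"] by simp

text \<open>The growth of \<open>k!\<close> makes combinations of the \<open>k! z - d k\<close> that lie in \<open>G\<close> expensive: if the top nonzero
  coefficient is at \<open>K\<close>, the lower ones must compensate \<open>K!\<close>, and each unit of \<open>k! \<le> K! / (k + 1)\<close>
  costs \<open>1 / (k + 1)\<close>.\<close>

lemma weight_0_cases:
  assumes "weight m L = 0" shows "word m L = \<one> \<or> 1 \<le> cost m L"
  using assms
proof (induction L)
  case (Suc K)
  show ?case
  proof (cases "m K = 0")
    case True
    then show ?thesis using Suc by (simp add: weight_def cost_def)
  next
    case False
    have "m K * fact K = - (\<Sum>k<K. m k * fact k)" using Suc.prems by (simp add: weight_def)
    then have "\<bar>m K * fact K\<bar> = \<bar>\<Sum>k<K. m k * fact k\<bar>" by (simp only: abs_minus)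
    then have "\<bar>m K\<bar> * fact K = \<bar>\<Sum>k<K. m k * fact k\<bar>" by (simp add: abs_mult)
    also have "\<dots> \<le> (\<Sum>k<K. \<bar>m k\<bar> * fact k)"
      using sum_abs[of "\<lambda>k. m k * fact k" "{..<K}"] by (simp add: abs_mult)
    finally have "\<bar>m K\<bar> * fact K \<le> (\<Sum>k<K. \<bar>m k\<bar> * fact k)" .
    moreover have "fact K \<le> \<bar>m K\<bar> * fact K" using False by simp
    ultimately have "fact K \<le> (\<Sum>k<K. \<bar>m k\<bar> * fact k)" by linarith
    then have "real_of_int (fact K) \<le> real_of_int (\<Sum>k<K. \<bar>m k\<bar> * fact k)"
      by (simp only: of_int_le_iff)
    then have "fact K \<le> (\<Sum>k<K. \<bar>real_of_int (m k)\<bar> * fact k)"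
      by simp
    also have "\<dots> \<le> (\<Sum>k<K. \<bar>real_of_int (m k)\<bar> / real (Suc k) * fact K)"
    proof (rule sum_mono)
      fix k assume "k \<in> {..<K}"
      then have "fact (Suc k) \<le> (fact K :: real)" by (intro fact_mono) simp
      then have "fact k \<le> fact K / real (Suc k)"
        by (simp add: field_simps)
      then show "\<bar>real_of_int (m k)\<bar> * fact k \<le> \<bar>real_of_int (m k)\<bar> / real (Suc k) * fact K"
        using mult_left_mono[of "fact k" "fact K / real (Suc k)" "\<bar>real_of_int (m k)\<bar>"] by simp
    qed
    also have "\<dots> = cost m K * fact K" by (simp add: cost_def sum_distrib_right)
    finally have "1 \<le> cost m K" by simp
    also have "cost m K \<le> cost m (Suc K)" by (simp add: cost_def)
    finally show ?thesis by simp
  qed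
qed simp

lemma ext_norm_0:
  assumes x: "x \<in> carrier G" shows "ext_norm x 0 = N x"
proof (rule antisym)
  show "ext_norm x 0 \<le> N x"
    using ext_norm_le[OF x, of "\<lambda>_. 0" 0] x by (simp add: weight_def cost_def)
  show "N x \<le> ext_norm x 0"
  proof (rule le_ext_norm)
    fix m L assume "weight m L = 0"
    then consider "word m L = \<one>" | "1 \<le> cost m L" using weight_0_cases by blast
    then show "N x \<le> N (x \<otimes> word m L) + cost m L"
    proof cases
      case 1
      then show ?thesis using x cost_nonneg by simp
    next
      case 2
      then show ?thesis using norm_le_1[OF x] norm_nonneg[of "x \<otimes> word m L"] x by simp
    qed
  qed
qed

text \<open>This estimates the decomposition of \<open>k! z - x\<close> into \<open>d k - x\<close>
  and \<open>k! z - d k\<close>; the witness is the unit coefficient at \<open>k\<close>.\<close>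

lemma ext_norm_fact:
  assumes x: "x \<in> carrier G"
  shows "ext_norm (inv x) (fact k) \<le> N (inv x \<otimes> d k) + 1 / real (Suc k)"
proof -
  let ?m = "\<lambda>j. if j = k then 1 else 0 :: int"
  have "word ?m L = \<one>" if "L \<le> k" for L using that by (induction L) auto
  moreover have "weight ?m (Suc k) = fact k" by (simp add: weight_def)
  moreover have "cost ?m (Suc k) = 1 / real (Suc k)" by (simp add: cost_def)
  ultimately show ?thesis using ext_norm_le[of "inv x" ?m "Suc k"] x by simp
qed

lemma ext_norm_small:
  assumes x: "x \<in> carrier G" and "e > 0" shows "\<exists>n. ext_norm (inv x) n < e"
proof -
  obtain M where M: "inverse (real (Suc M)) < e / 2"
    using reals_Archimedean[of "e / 2"] \<open>e > 0\<close> by auto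
  obtain k where k: "k \<ge> M" "N (inv x \<otimes> d k) < e / 2"
    using d_dense[OF x, of "e / 2" M] \<open>e > 0\<close> by auto
  have "1 / real (Suc k) \<le> inverse (real (Suc M))"
    using k(1) by (simp add: field_simps)
  then have "ext_norm (inv x) (fact k) < e" using ext_norm_fact[OF x, of k] M k(2) by linarith
  then show ?thesis ..
qed

sublocale group_seminorm "ext_norm \<one>"
proof
  show "ext_norm \<one> 0 = 0" by (simp add: ext_norm_0 norm_one)
  show "ext_norm \<one> (- n) = ext_norm \<one> n" for n using ext_norm_inv[of \<one> n] by simp
  show "ext_norm \<one> (m + n) \<le> ext_norm \<one> m + ext_norm \<one> n" for m n
    using ext_norm_triangle[of \<one> \<one> m n] by simp
qed

section \<open>The isometric embedding into the completion of the integers\<close>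

text \<open>The value at \<open>n\<close> is the distance from \<open>n z\<close> to
  \<open>x\<close>, that is, the seminorm of \<open>n z - x\<close>; this explains the
  inverse.\<close>

definition embed :: "'a \<Rightarrow> int \<Rightarrow> real" where
  "embed x = ext_norm (inv x)"

lemma embed_in_points:
  assumes x: "x \<in> carrier G" shows "embed x \<in> points"
proof -
  have "embed x m \<le> ext_norm \<one> (m - n) + embed x n" for m n
    using ext_norm_triangle[of \<one> "inv x" "m - n" n] x by (simp add: embed_def)
  moreover have "ext_norm \<one> (m - n) \<le> embed x m + embed x n" for m n
    using ext_norm_triangle[of "inv x" x m "- n"] ext_norm_inv[of "inv x" n] x
    by (simp add: embed_def)
  ultimately show ?thesis
    using ext_norm_small[OF x] by (auto simp: points_def embed_def)
qed

lemma conv_embed: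
  assumes "x \<in> carrier G" "y \<in> carrier G"
  shows "conv (embed x) (embed y) = embed (x \<otimes> y)"
  using assms ext_norm_triangle[of "inv x" "inv y"]
  by (intro conv_eqI embed_in_points) (auto simp: embed_def inv_mult)

text \<open>Passing from \<open>x\<close> to \<open>y\<close> through any \<open>j z\<close> costs
  at least \<open>N (x \<otimes> inv y)\<close>, by the triangle inequality and
  \<open>ext_norm_0\<close>. Choosing \<open>j z\<close> close to \<open>x\<close> makes the detour
  arbitrarily cheap.\<close>

lemma gap_embed:
  assumes x: "x \<in> carrier G" and y: "y \<in> carrier G"
  shows "gap (embed x) (embed y) = N (x \<otimes> inv y)"
proof (rule antisym)
  show "N (x \<otimes> inv y) \<le> gap (embed x) (embed y)"
    unfolding gap_def
  proof (rule cINF_greatest)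
    fix j
    have "N (x \<otimes> inv y) \<le> ext_norm x (- j) + ext_norm (inv y) j"
      using ext_norm_triangle[of x "inv y" "- j" j] x y by (simp add: ext_norm_0)
    then show "N (x \<otimes> inv y) \<le> embed x j + embed y j"
      using ext_norm_inv[of "inv x" j] x by (simp add: embed_def)
  qed simp
  show "gap (embed x) (embed y) \<le> N (x \<otimes> inv y)"
  proof (rule field_le_epsilon)
    fix e :: real assume "e > 0"
    then obtain j where j: "embed x j < e / 2"
      using ext_norm_small[OF x, of "e / 2"] by (auto simp: embed_def)
    have "inv x \<otimes> (x \<otimes> inv y) = inv y" using x y by (simp add: m_assoc[symmetric])
    then have "embed y j \<le> embed x j + N (x \<otimes> inv y)"
      using ext_norm_triangle[of "inv x" "x \<otimes> inv y" j 0] x y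
      by (simp add: embed_def ext_norm_0)
    then show "gap (embed x) (embed y) \<le> N (x \<otimes> inv y) + e"
      using gap_le[OF embed_in_points[OF x] embed_in_points[OF y], of j] j by linarith
  qed
qed

end

theorem theorem1p3:
  fixes G :: "('a, 'b) monoid_scheme" and T :: "'a topology"
  assumes "topological_group G T"
    and "comm_group G"
    and "separable_space T"
    and "metrizable_space T"
  shows "\<exists>(H :: real monoid) (S :: real topology).
           topological_group H S \<and> completely_metrizable_space S \<and> monothetic H S \<and>
           (\<exists>K. subgroup K H \<and>
                topological_group_iso G T (H\<lparr>carrier := K\<rparr>) (subtopology S K) \<noteq> {})"
proof -
  interpret topological_group G T by fact
  interpret comm_group G by fact
  obtain N where "normed_group G N" and N_le_1: "\<And>x. x \<in> carrier G \<Longrightarrow> N x \<le> 1"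
    and T: "T = Metric_space.mtopology (carrier G) (normed_group.norm_dist G N)"
    using Birkhoff_Kakutani[OF assms(2,4)] by blast
  then interpret normed_group G N by simp
  interpret Gd: Metric_space "carrier G" norm_dist by (rule Metric_space_norm_dist)
  obtain C where C: "countable C" "C \<subseteq> carrier G" "T closure_of C = carrier G"
    using assms(3) by (auto simp: separable_space_def topspace_eq_carrier)
  have "C \<noteq> {}" using C(3) by auto
  \<comment> \<open>Every element of \<open>C\<close> is enumerated infinitely often.\<close>
  define d where "d k = from_nat_into C (fst (prod_decode k))" for k
  have d_dense: "\<exists>k\<ge>M. N (inv\<^bsub>G\<^esub> x \<otimes>\<^bsub>G\<^esub> d k) < e" if x: "x \<in> carrier G" and "e > 0" for x e M
  proof -
    have "x \<in> Gd.mtopology closure_of C" using C(3) x T by simp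
    then obtain c where c: "c \<in> C" "norm_dist x c < e"
      using \<open>e > 0\<close> unfolding Gd.metric_closure_of by auto
    obtain i where i: "c = from_nat_into C i"
      using C(1) c(1) by (metis from_nat_into_surj)
    have "N (inv\<^bsub>G\<^esub> x \<otimes>\<^bsub>G\<^esub> c) < e"
      using c C(2) x Gd.commute[of x c] by (simp add: norm_dist_def m_comm subset_iff)
    \<comment> \<open>In \<open>prod_encode (i, M)\<close> the first component selects
      \<open>c\<close>, while the second only pushes the index up to at least
      \<open>M\<close>.\<close>
    then show ?thesis
      using i le_prod_encode_2[of M i] by (intro exI[of _ "prod_encode (i, M)"]) (simp add: d_def)
  qed
  interpret normed_group_sequence G N d
    using N_le_1 d_dense C(2) from_nat_into[OF \<open>C \<noteq> {}\<close>]
    by unfold_locales (auto simp: d_def)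
  obtain code :: "(int \<Rightarrow> real) \<Rightarrow> real" where code: "inj code"
    using inj_real_valued_functions_to_real by blast
  define H where "H = completion code"
  interpret H: comm_group H unfolding H_def by (rule comm_group_completion[OF code])
  interpret Hd: Metric_space "carrier H" "completion_dist code"
    unfolding H_def by (rule Metric_space_completion[OF code])
  define f where "f = code \<circ> embed"
  have f_carrier: "f ` carrier G \<subseteq> carrier H"
    by (auto simp: f_def H_def completion_def embed_in_points)
  have f_mult: "f (x \<otimes>\<^bsub>G\<^esub> y) = f x \<otimes>\<^bsub>H\<^esub> f y" if "x \<in> carrier G" "y \<in> carrier G" for x y
    using that by (simp add: f_def H_def completion_def the_inv_code[OF code] conv_embed)
  have f_dist: "completion_dist code (f x) (f y) = norm_dist x y"
    if "x \<in> carrier G" "y \<in> carrier G" for x y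
    using that by (simp add: f_def completion_dist_def the_inv_code[OF code] gap_embed
        norm_dist_def norm_nonneg)
  interpret GH: Metric_space12 "carrier G" norm_dist "carrier H" "completion_dist code" ..
  have emb: "embedding_map T Hd.mtopology f"
    unfolding T using f_carrier f_dist by (intro GH.isometry_imp_embedding_map) auto
  interpret f: group_hom G H f
    using f_carrier f_mult by unfold_locales (auto simp: hom_def)
  let ?K = "f ` carrier G"
  have "subgroup ?K H" by (rule f.img_is_subgroup)
  moreover have "homeomorphic_map T (subtopology Hd.mtopology ?K) f"
    using emb by (simp add: embedding_map_def topspace_eq_carrier)
  moreover have "f \<in> iso G (H\<lparr>carrier := ?K\<rparr>)"
  proof -
    have "inj_on f (carrier G)"
      using homeomorphic_imp_injective_map[OF calculation(2)] by (simp add: topspace_eq_carrier)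
    then show ?thesis using f_mult by (auto simp: iso_def hom_def bij_betw_def)
  qed
  moreover have "topological_group H Hd.mtopology" "completely_metrizable_space Hd.mtopology"
    unfolding H_def by (rule topological_group_completion[OF code],
        rule completely_metrizable_completion[OF code])
  moreover have "monothetic H Hd.mtopology"
    unfolding H_def by (rule monothetic_completion[OF group_seminorm_axioms code])
  ultimately show ?thesis
    unfolding topological_group_iso_def by blast
qed

end
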